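(* Let $p,q\in\mathbb{Z}$ with $\min\{p+q,\,p-q\}\geq 0$. Then \[ \frac{4(-1)^q}{3^{3q+\frac{1}{2}}\,\pi}=\Big(\frac{1}{2}\Big)_{p+2q+1} \sum_{k=0}^{\infty}\frac{(\frac{3}{2})_{k+3p}(\frac{3}{2})_{k+3q}(-\frac{1}{2})_{2k-3q}} {k!\,(k+p-q)!\,(2k+3p+3q+2)!}\cdot\frac{8k+6p+3}{9^k}. \]
   Context: For a complex number $x$ and an integer $n$ (possibly negative), the shifted factorial is defined by $(x)_n=\Gamma(x+n)/\Gamma(x)$, where $\Gamma$ is the Gamma function. *)

theory Defs
  imports "HOL-Analysis.Analysis"
begin

text \<open>
  The index is an integer and may be negative, so this is not \<^const>\<open>pochhammer\<close>, whose index is a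
  natural number. If \<open>x\<close> or \<open>x + n\<close> is a non-positive integer, a pole of \<^const>\<open>Gamma\<close>, the value
  is \<open>0\<close> by the conventions \<open>Gamma = 0\<close> at poles and \<open>z / 0 = 0\<close>.
\<close>

definition shifted_factorial :: "complex \<Rightarrow> int \<Rightarrow> complex" where
  "shifted_factorial x n = Gamma (x + of_int n) / Gamma x"

end

theory Submission
  imports Defs "HOL-Real_Asymp.Real_Asymp"
begin

text \<open>
  The sum does not depend on \<open>p\<close>: multiplied by the Gamma factor of \<open>(1/2)_{p+2q+1}\<close>, the summand
  \<open>F(p,k)\<close> is part of a Wilf-Zeilberger pair, \<open>F(p+1,k) - F(p,k) = G(k+1) - G(k)\<close> with
  \<open>G/F = 9k(2k+4p+2q+3) / ((8k+6p+3)(2k+3p+3q+3))\<close>, where \<open>G(0) = 0\<close> and \<open>G(k)\<close> tends to \<open>0\<close>.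
  As \<open>p\<close> tends to infinity, only the term \<open>k = 0\<close> survives (Tannery), and its limit follows from
  \<open>\<Gamma>(n+a) ~ (n-1)! n^a\<close> and the reflection formula.
\<close>

section \<open>Gamma at shifted arguments, a ratio test, and the growth of Gamma\<close>

text \<open>Half-integers are never poles of Gamma, whatever their sign. This justifies the
  recurrence of Gamma at arguments such as \<open>3 * q + k + 3/2\<close> or
  \<open>p + 2 * q + 3/2\<close>, which may be negative.\<close>

lemma nonpos_Ints_add_half:
  assumes "y \<in> \<int>" "x = y + 1/2"
  shows "(x::real) \<notin> \<int>\<^sub>\<le>\<^sub>0"
proof
  assume "x \<in> \<int>\<^sub>\<le>\<^sub>0"
  then obtain m where "x = of_int m" by (auto simp: nonpos_Ints_def)
  moreover obtain n where "y = of_int n" using assms(1) by (elim Ints_cases)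
  ultimately have "2 * m = 2 * n + 1" using assms(2) by linarith
  thus False by presburger
qed

lemma Gamma_plus2:
  assumes "x \<notin> \<int>\<^sub>\<le>\<^sub>0"
  shows "Gamma (x + 2 :: real) = (x + 1) * x * Gamma x"
proof -
  have "x + 1 \<notin> \<int>\<^sub>\<le>\<^sub>0" using plus_one_in_nonpos_Ints_imp assms by blast
  thus ?thesis using Gamma_plus1[of "x + 1"] Gamma_plus1[of x] assms
    by (simp add: add.assoc)
qed

lemma Gamma_plus3:
  assumes "x \<notin> \<int>\<^sub>\<le>\<^sub>0"
  shows "Gamma (x + 3 :: real) = (x + 2) * (x + 1) * x * Gamma x"
proof -
  have "x + 1 \<notin> \<int>\<^sub>\<le>\<^sub>0" using plus_one_in_nonpos_Ints_imp assms by blast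
  thus ?thesis using Gamma_plus2[of "x + 1"] Gamma_plus1[of x] assms
    by (simp add: add.assoc mult.assoc)
qed

text \<open>The ratio enters through a multiplicative recurrence, so no term of \<open>f\<close> has
  to be shown nonzero. It serves both the series itself and its majorant.\<close>

lemma summable_ratio_tendsto:
  fixes f r :: "nat \<Rightarrow> real"
  assumes rec: "\<And>n. f (Suc n) = r n * f n" and lim: "r \<longlonglongrightarrow> l" and l: "\<bar>l\<bar> < 1"
  shows "summable f"
proof -
  obtain c where c: "\<bar>l\<bar> < c" "c < 1" using l dense by blast
  have "(\<lambda>n. \<bar>r n\<bar>) \<longlonglongrightarrow> \<bar>l\<bar>" using lim by (rule tendsto_rabs)
  hence "eventually (\<lambda>n. \<bar>r n\<bar> < c) sequentially" using c(1) by (rule order_tendstoD)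
  then obtain N where N: "\<And>n. n \<ge> N \<Longrightarrow> \<bar>r n\<bar> < c" by (auto simp: eventually_sequentially)
  show ?thesis
  proof (rule summable_ratio_test[of c N f])
    fix n assume "n \<ge> N"
    thus "norm (f (Suc n)) \<le> c * norm (f n)"
      using N[of n] by (auto simp: rec abs_mult intro!: mult_right_mono)
  qed (use c in auto)
qed

text \<open>\<open>Gamma_series' a n\<close> is \<open>(n-1)! n^a / (a)_n\<close> and tends to
  \<open>Gamma a\<close>; since \<open>(a)_n = Gamma (a + n) / Gamma a\<close>, dividing
  \<open>Gamma a\<close> by it gives exactly the quotient in question.\<close>

lemma Gamma_shift_asymptotic:
  assumes "a \<notin> \<int>\<^sub>\<le>\<^sub>0"
  shows "(\<lambda>n. Gamma (a + real n) / (fact (n - 1) * real n powr a)) \<longlonglongrightarrow> 1"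
proof -
  have nz: "Gamma a \<noteq> 0" using assms by (simp add: Gamma_eq_zero_iff)
  have "(\<lambda>n. Gamma a / Gamma_series' a n) \<longlonglongrightarrow> Gamma a / Gamma a"
    by (intro tendsto_intros Gamma_series'_LIMSEQ nz)
  moreover have "eventually (\<lambda>n. Gamma a / Gamma_series' a n
      = Gamma (a + real n) / (fact (n - 1) * real n powr a)) sequentially"
    using eventually_gt_at_top[of 0]
    by eventually_elim
       (use nz in \<open>simp add: Gamma_series'_def pochhammer_Gamma assms powr_def field_simps\<close>)
  ultimately show ?thesis using nz by (simp cong: filterlim_cong)
qed

section \<open>The Wilf-Zeilberger pair\<close>

text \<open>The Gamma values at \<open>1/2\<close>, \<open>3/2\<close> and \<open>- 1/2\<close>,
  constant in \<open>p\<close>, \<open>q\<close> and \<open>k\<close>, are left out, and so is the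
  linear factor \<open>8k + 6p + 3\<close>. What remains is a pure Gamma quotient, whose shifts
  follow from the recurrence of Gamma alone.\<close>

definition wz_term :: "int \<Rightarrow> int \<Rightarrow> nat \<Rightarrow> real" where
  "wz_term p q k = Gamma (p + 2 * q + 3/2) * Gamma (3 * p + real k + 3/2) * Gamma (3 * q + real k + 3/2)
     * Gamma (2 * real k - 3 * q - 1/2)
     / (fact k * Gamma (p - q + real k + 1) * Gamma (3 * p + 3 * q + 2 * real k + 3) * 9 ^ k)"

definition wz_summand :: "int \<Rightarrow> int \<Rightarrow> nat \<Rightarrow> real" where
  "wz_summand p q k = (8 * real k + 6 * p + 3) * wz_term p q k"

text \<open>The function \<open>G\<close> of the pair: the denominator \<open>8k + 6p + 3\<close> of
  \<open>G/F\<close> has cancelled against the linear factor of \<open>F\<close>.\<close>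

definition wz_mate :: "int \<Rightarrow> int \<Rightarrow> nat \<Rightarrow> real" where
  "wz_mate p q k = 9 * real k * (2 * real k + 4 * p + 2 * q + 3) / (3 * p + 3 * q + 2 * real k + 3) * wz_term p q k"

text \<open>The quotient of consecutive values of \<open>wz_term\<close> in \<open>k\<close>. Real
  arguments make it a plain rational function, open to limits and estimates in \<open>P\<close> as
  well as in \<open>k\<close>.\<close>

definition wz_ratio :: "real \<Rightarrow> real \<Rightarrow> real \<Rightarrow> real" where
  "wz_ratio P Q k = (3 * P + k + 3/2) * (3 * Q + k + 3/2) * (2 * k - 3 * Q - 1/2) * (2 * k - 3 * Q + 1/2)
     / (9 * (k + 1) * (P - Q + k + 1) * (3 * P + 3 * Q + 2 * k + 3) * (3 * P + 3 * Q + 2 * k + 4))"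

lemma wz_term_Suc:
  assumes "\<bar>q\<bar> \<le> p"
  shows "wz_term p q (Suc k) = wz_ratio p q k * wz_term p q k"
proof -
  define P Q K where "P = real_of_int p" and "Q = real_of_int q" and "K = real k"
  have PQ: "P - Q \<ge> 0" "P + Q \<ge> 0" "K \<ge> 0" using assms by (auto simp: P_def Q_def K_def)
  have I: "P \<in> \<int>" "Q \<in> \<int>" "K \<in> \<int>" by (auto simp: P_def Q_def K_def)
  have h1: "3 * P + K + 3/2 \<notin> \<int>\<^sub>\<le>\<^sub>0"
    by (rule nonpos_Ints_add_half[of "3 * P + K + 1"]) (use I in auto)
  have h2: "3 * Q + K + 3/2 \<notin> \<int>\<^sub>\<le>\<^sub>0"
    by (rule nonpos_Ints_add_half[of "3 * Q + K + 1"]) (use I in auto)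
  have h3: "2 * K - 3 * Q - 1/2 \<notin> \<int>\<^sub>\<le>\<^sub>0"
    by (rule nonpos_Ints_add_half[of "2 * K - 3 * Q - 1"]) (use I in auto)
  have h4: "P - Q + K + 1 \<notin> \<int>\<^sub>\<le>\<^sub>0" and h5: "3 * P + 3 * Q + 2 * K + 3 \<notin> \<int>\<^sub>\<le>\<^sub>0"
    using PQ by (auto simp: nonpos_Ints_def)
  have e1: "Gamma (3 * P + (K + 1) + 3/2) = (3 * P + K + 3/2) * Gamma (3 * P + K + 3/2)"
    using Gamma_plus1[OF h1] by (simp add: algebra_simps)
  have e2: "Gamma (3 * Q + (K + 1) + 3/2) = (3 * Q + K + 3/2) * Gamma (3 * Q + K + 3/2)"
    using Gamma_plus1[OF h2] by (simp add: algebra_simps)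
  have "2 * (K + 1) - 3 * Q - 1/2 = (2 * K - 3 * Q - 1/2) + 2" by simp
  hence e3: "Gamma (2 * (K + 1) - 3 * Q - 1/2)
      = (2 * K - 3 * Q + 1/2) * (2 * K - 3 * Q - 1/2) * Gamma (2 * K - 3 * Q - 1/2)"
    using Gamma_plus2[OF h3] by simp
  have e4: "Gamma (P - Q + (K + 1) + 1) = (P - Q + K + 1) * Gamma (P - Q + K + 1)"
    using Gamma_plus1[OF h4] by (simp add: algebra_simps)
  have "3 * P + 3 * Q + 2 * (K + 1) + 3 = (3 * P + 3 * Q + 2 * K + 3) + 2" by simp
  hence e5: "Gamma (3 * P + 3 * Q + 2 * (K + 1) + 3)
      = (3 * P + 3 * Q + 2 * K + 4) * (3 * P + 3 * Q + 2 * K + 3) * Gamma (3 * P + 3 * Q + 2 * K + 3)"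
    using Gamma_plus2[OF h5] by simp
  have e6: "fact (Suc k) = (K + 1) * fact k" by (simp add: K_def)
  have e7: "real (Suc k) = K + 1" by (simp add: K_def)
  show ?thesis
    unfolding wz_term_def e6 e7 P_def[symmetric] Q_def[symmetric] K_def[symmetric] e1 e2 e3 e4 e5 wz_ratio_def times_divide_times_eq
    by (rule arg_cong2[where f = "(/)"]) (simp_all only: mult_ac power_Suc)
qed

text \<open>Raising \<open>p\<close> by one moves two Gamma arguments above and two below the
  fraction bar, by 1 and by 3 each time; the factors free of \<open>p\<close> cancel. Clearing
  denominators keeps the statement polynomial.\<close>

lemma wz_term_shift:
  assumes "\<bar>q\<bar> \<le> p"
  shows "wz_term (p + 1) q k * (p - q + real k + 1) * (3 * p + 3 * q + 2 * real k + 3)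
           * (3 * p + 3 * q + 2 * real k + 4) * (3 * p + 3 * q + 2 * real k + 5)
       = (p + 2 * q + 3/2) * (3 * p + real k + 3/2) * (3 * p + real k + 5/2) * (3 * p + real k + 7/2) * wz_term p q k"
proof -
  define P Q K where "P = real_of_int p" and "Q = real_of_int q" and "K = real k"
  have PQ: "P - Q \<ge> 0" "P + Q \<ge> 0" "K \<ge> 0" using assms by (auto simp: P_def Q_def K_def)
  have I: "P \<in> \<int>" "Q \<in> \<int>" "K \<in> \<int>" by (auto simp: P_def Q_def K_def)
  have h1: "3 * P + K + 3/2 \<notin> \<int>\<^sub>\<le>\<^sub>0"
    by (rule nonpos_Ints_add_half[of "3 * P + K + 1"]) (use I in auto)
  have h2: "P + 2 * Q + 3/2 \<notin> \<int>\<^sub>\<le>\<^sub>0"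
    by (rule nonpos_Ints_add_half[of "P + 2 * Q + 1"]) (use I in auto)
  have h4: "P - Q + K + 1 \<notin> \<int>\<^sub>\<le>\<^sub>0" and h5: "3 * P + 3 * Q + 2 * K + 3 \<notin> \<int>\<^sub>\<le>\<^sub>0"
    using PQ by (auto simp: nonpos_Ints_def)
  have e2: "Gamma ((P + 1) + 2 * Q + 3/2) = (P + 2 * Q + 3/2) * Gamma (P + 2 * Q + 3/2)"
    using Gamma_plus1[OF h2] by (simp add: algebra_simps)
  have "3 * (P + 1) + K + 3/2 = (3 * P + K + 3/2) + 3" by simp
  hence e1: "Gamma (3 * (P + 1) + K + 3/2)
      = (3 * P + K + 7/2) * (3 * P + K + 5/2) * (3 * P + K + 3/2) * Gamma (3 * P + K + 3/2)"
    using Gamma_plus3[OF h1] by (simp only: add.assoc) simp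
  have e4: "Gamma ((P + 1) - Q + K + 1) = (P - Q + K + 1) * Gamma (P - Q + K + 1)"
    using Gamma_plus1[OF h4] by (simp add: algebra_simps)
  have "3 * (P + 1) + 3 * Q + 2 * K + 3 = (3 * P + 3 * Q + 2 * K + 3) + 3" by simp
  hence e5: "Gamma (3 * (P + 1) + 3 * Q + 2 * K + 3)
      = (3 * P + 3 * Q + 2 * K + 5) * (3 * P + 3 * Q + 2 * K + 4) * (3 * P + 3 * Q + 2 * K + 3)
        * Gamma (3 * P + 3 * Q + 2 * K + 3)"
    using Gamma_plus3[OF h5] by (simp only: add.assoc) simp
  have nz: "P - Q + K + 1 \<noteq> 0" "3 * P + 3 * Q + 2 * K + 3 \<noteq> 0"
    "3 * P + 3 * Q + 2 * K + 4 \<noteq> 0" "3 * P + 3 * Q + 2 * K + 5 \<noteq> 0" using PQ by linarith+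
  have e7: "real_of_int (p + 1) = P + 1" by (simp add: P_def)
  show ?thesis
    unfolding wz_term_def e7 P_def[symmetric] Q_def[symmetric] K_def[symmetric] e1 e2 e4 e5
    using nz by (simp, simp only: mult_ac)
qed

lemma wz_pair:
  assumes "\<bar>q\<bar> \<le> p"
  shows "wz_summand (p + 1) q k - wz_summand p q k = wz_mate p q (Suc k) - wz_mate p q k"
proof -
  define P Q K t where "P = real_of_int p" and "Q = real_of_int q" and "K = real k"
    and "t = wz_term p q k"
  define a b c d where "a = P - Q + K + 1" and "b = 3 * P + 3 * Q + 2 * K + 3"
    and "c = 3 * P + 3 * Q + 2 * K + 4" and "d = 3 * P + 3 * Q + 2 * K + 5"
  have PQ: "P - Q \<ge> 0" "P + Q \<ge> 0" "K \<ge> 0" using assms by (auto simp: P_def Q_def K_def)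
  have nz: "a \<noteq> 0" "b \<noteq> 0" "c \<noteq> 0" "d \<noteq> 0" "K + 1 \<noteq> 0"
    using PQ unfolding a_def b_def c_def d_def by linarith+
  have s: "wz_term (p + 1) q k
     = (P + 2 * Q + 3/2) * (3 * P + K + 3/2) * (3 * P + K + 5/2) * (3 * P + K + 7/2) * t / (a * b * c * d)"
  proof -
    have "wz_term (p + 1) q k * a * b * c * d
      = (P + 2 * Q + 3/2) * (3 * P + K + 3/2) * (3 * P + K + 5/2) * (3 * P + K + 7/2) * t"
      using wz_term_shift[OF assms, of k]
      by (simp only: P_def Q_def K_def t_def a_def b_def c_def d_def)
    thus ?thesis using nz by (simp add: eq_divide_eq mult_ac)
  qed
  have r: "wz_term p q (Suc k)
     = (3 * P + K + 3/2) * (3 * Q + K + 3/2) * (2 * K - 3 * Q - 1/2) * (2 * K - 3 * Q + 1/2)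
        / (9 * (K + 1) * a * b * c) * t"
    unfolding wz_term_Suc[OF assms] wz_ratio_def by (simp add: P_def Q_def K_def t_def a_def b_def c_def)
  have F1: "wz_summand (p + 1) q k = (8 * K + 6 * P + 9) * wz_term (p + 1) q k"
    by (simp add: wz_summand_def P_def K_def)
  have F0: "wz_summand p q k = (8 * K + 6 * P + 3) * t"
    by (simp add: wz_summand_def P_def K_def t_def)
  have G0: "wz_mate p q k = 9 * K * (2 * K + 4 * P + 2 * Q + 3) / b * t"
    by (simp add: wz_mate_def P_def Q_def K_def t_def b_def)
  have G1: "wz_mate p q (Suc k) = 9 * (K + 1) * (2 * K + 4 * P + 2 * Q + 5) / d * wz_term p q (Suc k)"
    by (simp add: wz_mate_def P_def Q_def K_def d_def algebra_simps)
  \<comment> \<open>This is the claim divided by \<open>t\<close> and multiplied by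
    \<open>a * b * c * d\<close>. That denominator is common to all terms because
    \<open>9 * (K + 1)\<close> in \<open>G(k+1)\<close> cancels against the same factor in the term
    ratio.\<close>
  have poly: "(8 * K + 6 * P + 9) * ((P + 2 * Q + 3/2) * (3 * P + K + 3/2) * (3 * P + K + 5/2) * (3 * P + K + 7/2))
       - (8 * K + 6 * P + 3) * (a * b * c * d)
     = (2 * K + 4 * P + 2 * Q + 5)
         * ((3 * P + K + 3/2) * (3 * Q + K + 3/2) * (2 * K - 3 * Q - 1/2) * (2 * K - 3 * Q + 1/2))
       - 9 * K * (2 * K + 4 * P + 2 * Q + 3) * (a * c * d)"
    unfolding a_def b_def c_def d_def by algebra
  have "wz_summand (p + 1) q k - wz_summand p q k
     = ((8 * K + 6 * P + 9) * ((P + 2 * Q + 3/2) * (3 * P + K + 3/2) * (3 * P + K + 5/2) * (3 * P + K + 7/2))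
       - (8 * K + 6 * P + 3) * (a * b * c * d)) * t / (a * b * c * d)"
    unfolding F1 F0 s using nz by (simp only: diff_divide_distrib left_diff_distrib) simp
  also have "\<dots> = wz_mate p q (Suc k) - wz_mate p q k"
    unfolding poly G0 G1 r using nz
    by (simp only: diff_divide_distrib left_diff_distrib) (simp, simp only: mult_ac)
  finally show ?thesis .
qed

section \<open>Convergence of the series and independence of its sum from \<open>p\<close>\<close>

lemma wz_summand_Suc:
  assumes "\<bar>q\<bar> \<le> p"
  shows "wz_summand p q (Suc k)
    = (8 * real k + 6 * p + 11) / (8 * real k + 6 * p + 3) * wz_ratio p q k * wz_summand p q k"
proof -
  have "8 * real k + 6 * p + 3 \<noteq> 0" using assms by linarith
  thus ?thesis by (simp add: wz_summand_def wz_term_Suc[OF assms])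
qed

lemma wz_summand_summable:
  assumes "\<bar>q\<bar> \<le> p"
  shows "summable (wz_summand p q)"
proof (rule summable_ratio_tendsto)
  show "wz_summand p q (Suc k)
    = (8 * real k + 6 * p + 11) / (8 * real k + 6 * p + 3) * wz_ratio p q k * wz_summand p q k" for k
    by (rule wz_summand_Suc[OF assms])
  \<comment> \<open>The numerator and denominator of \<open>wz_ratio\<close> are both quartic in
    \<open>k\<close>, with leading coefficients 4 and 36.\<close>
  show "(\<lambda>k. (8 * real k + 6 * p + 11) / (8 * real k + 6 * p + 3) * wz_ratio p q k) \<longlonglongrightarrow> 1/9"
    unfolding wz_ratio_def by real_asymp
qed auto

text \<open>The quotient \<open>G/F\<close> converges as \<open>k\<close> grows, so \<open>G\<close>
  inherits the decay of the terms of a convergent series.\<close>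

lemma wz_mate_tendsto_0:
  assumes "\<bar>q\<bar> \<le> p"
  shows "wz_mate p q \<longlonglongrightarrow> 0"
proof -
  have "(\<lambda>k. 9 * real k * (2 * real k + 4 * p + 2 * q + 3) / ((3 * p + 3 * q + 2 * real k + 3) * (8 * real k + 6 * p + 3)))
    \<longlonglongrightarrow> 9/8" by real_asymp
  from tendsto_mult[OF this summable_LIMSEQ_zero[OF wz_summand_summable[OF assms]]]
  have "(\<lambda>k. 9 * real k * (2 * real k + 4 * p + 2 * q + 3) / ((3 * p + 3 * q + 2 * real k + 3) * (8 * real k + 6 * p + 3))
    * wz_summand p q k) \<longlonglongrightarrow> 0" by simp
  moreover have "9 * real k * (2 * real k + 4 * p + 2 * q + 3) / ((3 * p + 3 * q + 2 * real k + 3) * (8 * real k + 6 * p + 3))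
    * wz_summand p q k = wz_mate p q k" for k
  proof -
    have "8 * real k + 6 * p + 3 \<noteq> 0" using assms by linarith
    thus ?thesis by (simp add: wz_summand_def wz_mate_def)
  qed
  ultimately show ?thesis by simp
qed

lemma suminf_wz_summand_shift:
  assumes "\<bar>q\<bar> \<le> p"
  shows "suminf (wz_summand (p + int n) q) = suminf (wz_summand p q)"
proof (induction n)
  case (Suc n)
  let ?p = "p + int n"
  have le: "\<bar>q\<bar> \<le> ?p" "\<bar>q\<bar> \<le> ?p + 1" using assms by auto
  have "(\<lambda>k. wz_summand (?p + 1) q k - wz_summand ?p q k) sums (0 - wz_mate ?p q 0)"
    unfolding wz_pair[OF le(1)] by (rule telescope_sums[OF wz_mate_tendsto_0[OF le(1)]])
  hence "suminf (\<lambda>k. wz_summand (?p + 1) q k - wz_summand ?p q k) = 0"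
    by (simp add: sums_iff wz_mate_def)
  hence "suminf (wz_summand (?p + 1) q) = suminf (wz_summand ?p q)"
    using suminf_diff[OF wz_summand_summable[OF le(2)] wz_summand_summable[OF le(1)]] by simp
  thus ?case using Suc.IH by (simp add: add_ac)
qed simp


section \<open>A majorant uniform in \<open>p\<close>\<close>

text \<open>Each ratio need not be below \<open>1\<close>, but the bound is free of \<open>P\<close> and tends to \<open>1/2\<close> in \<open>k\<close>.\<close>

lemma wz_ratio_bound:
  assumes "4 * \<bar>Q\<bar> + 11 \<le> P"
  shows "\<bar>(8 * real k + 6 * P + 11) / (8 * real k + 6 * P + 3) * wz_ratio P Q k\<bar>
           \<le> \<bar>3 * Q + real k + 3/2\<bar> / (2 * (real k + 1))"
proof -
  define K where "K = real k"
  have K: "K \<ge> 0" by (simp add: K_def)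
  \<comment> \<open>Only the factor \<open>(3 * Q + K + 3/2) / (K + 1)\<close> and the constant 1/9
    stay outside \<open>u\<close>, \<open>v\<close>, \<open>w\<close>. Here
    \<open>u \<le> 9/8\<close> uses \<open>P \<ge> 11\<close>, \<open>v \<le> 4\<close> uses
    \<open>P \<ge> 4 * |Q|\<close>, and \<open>9/8 * 4 * 1 / 9 = 1/2\<close>.\<close>
  define u v w where "u = (8 * K + 6 * P + 11) / (8 * K + 6 * P + 3)"
    and "v = (3 * P + K + 3/2) / (P - Q + K + 1)"
    and "w = (2 * K - 3 * Q - 1/2) * (2 * K - 3 * Q + 1/2)
              / ((3 * P + 3 * Q + 2 * K + 3) * (3 * P + 3 * Q + 2 * K + 4))"
  have "0 \<le> u" "u \<le> 9/8" using assms K by (auto simp: u_def field_simps)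
  moreover have "0 \<le> v" "v \<le> 4" using assms K by (auto simp: v_def field_simps)
  moreover have "\<bar>w\<bar> \<le> 1"
  proof -
    have "\<bar>2 * K - 3 * Q - 1/2\<bar> \<le> 3 * P + 3 * Q + 2 * K + 3"
      "\<bar>2 * K - 3 * Q + 1/2\<bar> \<le> 3 * P + 3 * Q + 2 * K + 4" using assms K by linarith+
    from mult_mono[OF this] show ?thesis
      using assms K by (auto simp: w_def abs_mult divide_le_eq_1)
  qed
  ultimately have "u * v * \<bar>w\<bar> \<le> 9/8 * 4 * 1" by (intro mult_mono) auto
  hence "u * v * \<bar>w\<bar> / 9 * (\<bar>3 * Q + K + 3/2\<bar> / (K + 1)) \<le> 1/2 * (\<bar>3 * Q + K + 3/2\<bar> / (K + 1))"
    using K by (intro mult_right_mono) auto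
  moreover have "\<bar>u * wz_ratio P Q K\<bar> = u * v * \<bar>w\<bar> / 9 * (\<bar>3 * Q + K + 3/2\<bar> / (K + 1))"
  proof -
    have "u * wz_ratio P Q K = u * v * w / 9 * ((3 * Q + K + 3/2) / (K + 1))"
      by (simp only: wz_ratio_def v_def w_def times_divide_times_eq times_divide_eq_left
            times_divide_eq_right divide_divide_eq_left mult_ac)
    thus ?thesis using \<open>0 \<le> u\<close> \<open>0 \<le> v\<close> K by (simp add: abs_mult)
  qed
  ultimately show ?thesis unfolding u_def K_def by simp
qed

text \<open>Iterating the ratio bound from \<open>k = 0\<close> gives a majorant in which
  \<open>p\<close> occurs no more, provided one \<open>B\<close> bounds the initial terms for all
  \<open>p\<close> considered.\<close>

lemma wz_summand_bound:
  assumes "4 * \<bar>q\<bar> + 11 \<le> p" "\<bar>wz_summand p q 0\<bar> \<le> B"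
  shows "\<bar>wz_summand p q k\<bar> \<le> B * (\<Prod>j<k. \<bar>3 * q + real j + 3/2\<bar> / (2 * (real j + 1)))"
proof (induction k)
  case (Suc k)
  have "\<bar>q\<bar> \<le> p" "4 * \<bar>real_of_int q\<bar> + 11 \<le> p" using assms(1) by linarith+
  note b = wz_ratio_bound[OF this(2), of k] and rec = wz_summand_Suc[OF this(1), of k]
  have "\<bar>wz_summand p q (Suc k)\<bar>
      \<le> (\<bar>3 * q + real k + 3/2\<bar> / (2 * (real k + 1))) * (B * (\<Prod>j<k. \<bar>3 * q + real j + 3/2\<bar> / (2 * (real j + 1))))"
    unfolding rec abs_mult[of _ "wz_summand p q k"]
    by (rule mult_mono) (use b Suc.IH in auto)
  thus ?case by (simp add: mult_ac)
qed (use assms in simp)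

lemma wz_majorant_summable:
  "summable (\<lambda>k. B * (\<Prod>j<k. \<bar>3 * real_of_int q + real j + 3/2\<bar> / (2 * (real j + 1))))"
proof (rule summable_ratio_tendsto)
  show "(\<lambda>k. \<bar>3 * real_of_int q + real k + 3/2\<bar> / (2 * (real k + 1))) \<longlonglongrightarrow> 1/2" by real_asymp
qed auto

section \<open>Limits of the single terms as \<open>p\<close> tends to infinity\<close>

text \<open>These are the two Gamma factors of the \<open>k = 0\<close> term that do not involve
  \<open>p\<close>. Their arguments add up to 1, so reflection applies; the sine is
  \<open>- cos (3 q pi)\<close>, and \<open>3q\<close> has the parity of \<open>q\<close>.\<close>

lemma Gamma_reflection_three_halves:
  "Gamma (3 * real_of_int q + 3/2) * Gamma (- 3 * real_of_int q - 1/2) = - pi * (- 1) powi q"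
proof -
  define z where "z = 3 * real_of_int q + 3/2"
  have s: "sin (pi * z) = - ((- 1) powi q)"
  proof -
    have "pi * z = (real_of_int (3 * q) * pi + pi/2) + pi" by (simp add: z_def algebra_simps)
    hence "sin (pi * z) = - cos (of_int (3 * q) * pi)" by (simp only: sin_periodic_pi) (simp add: sin_add)
    also have "cos (of_int (3 * q) * pi) = (- 1) powi q"
      using cos_npi_int[of "3 * q"] by (simp add: power_int_minus_left mult_ac)
    finally show ?thesis .
  qed
  have "complex_of_real (Gamma z * Gamma (1 - z)) = Gamma (of_real z) * Gamma (1 - of_real z)"
    by (simp flip: Gamma_complex_of_real)
  also have "\<dots> = of_real (pi / sin (pi * z))"
    unfolding Gamma_reflection_complex by (simp flip: sin_of_real)
  finally have "Gamma z * Gamma (1 - z) = pi / sin (pi * z)" by (simp only: of_real_eq_iff)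
  also have "\<dots> = - pi * (- 1) powi q"
    unfolding s by (cases "even q") (auto simp: power_int_minus_left)
  also have "1 - z = - 3 * real_of_int q - 1/2" by (simp add: z_def)
  finally show ?thesis by (simp only: z_def)
qed

lemma wz_summand_0_tendsto:
  assumes "\<bar>q\<bar> \<le> p"
  shows "(\<lambda>n. wz_summand (p + int n) q 0)
           \<longlonglongrightarrow> - 2 * pi * (- 1) powi q * 3 powr (- 3 * real_of_int q - 1/2)"
proof -
  define P Q where "P = real_of_int p" and "Q = real_of_int q"
  define a b c d where "a = P + 2 * Q + 3/2" and "b = 3 * P + 3/2"
    and "c = P - Q + 1" and "d = 3 * P + 3 * Q + 3"
  have PQ: "P - Q \<ge> 0" "P + Q \<ge> 0" "P \<ge> 0" using assms by (auto simp: P_def Q_def)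
  have I: "P \<in> \<int>" "Q \<in> \<int>" by (auto simp: P_def Q_def)
  have a: "a \<notin> \<int>\<^sub>\<le>\<^sub>0"
    by (rule nonpos_Ints_add_half[of "P + 2 * Q + 1"]) (use I in \<open>auto simp: a_def\<close>)
  have bcd: "b \<notin> \<int>\<^sub>\<le>\<^sub>0" "c \<notin> \<int>\<^sub>\<le>\<^sub>0" "d \<notin> \<int>\<^sub>\<le>\<^sub>0"
    using PQ by (auto simp: nonpos_Ints_def b_def c_def d_def)
  define g where "g = (\<lambda>x n. Gamma (x + real n) / (fact (n - 1) * real n powr x))"
  have g: "g x \<longlonglongrightarrow> 1" if "x \<notin> \<int>\<^sub>\<le>\<^sub>0" for x
    unfolding g_def by (rule Gamma_shift_asymptotic[OF that])
  \<comment> \<open>The arguments containing \<open>3 * p\<close> advance by 3 when \<open>p\<close>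
    advances by 1.\<close>
  have g3: "(\<lambda>n. g x (3 * n)) \<longlonglongrightarrow> 1" if "x \<notin> \<int>\<^sub>\<le>\<^sub>0" for x
    using LIMSEQ_subseq_LIMSEQ[OF g[OF that], of "\<lambda>n. 3 * n"]
    by (simp add: strict_mono_def comp_def)
  have lim: "(\<lambda>n. (6 * P + 6 * n + 3) / real n) \<longlonglongrightarrow> 6" by real_asymp
  have "(\<lambda>n. - pi * (- 1) powi q * 3 powr (- 3 * Q - 3/2) * ((6 * P + 6 * n + 3) / real n)
     * (g a n * g b (3 * n) / (g c n * g d (3 * n))))
     \<longlonglongrightarrow> - pi * (- 1) powi q * 3 powr (- 3 * Q - 3/2) * 6 * (1 * 1 / (1 * 1))"
    by (intro tendsto_mult tendsto_divide tendsto_const lim g g3 a bcd) auto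
  moreover have "eventually (\<lambda>n. - pi * (- 1) powi q * 3 powr (- 3 * Q - 3/2) * ((6 * P + 6 * n + 3) / real n)
     * (g a n * g b (3 * n) / (g c n * g d (3 * n))) = wz_summand (p + int n) q 0) sequentially"
    using eventually_gt_at_top[of 0]
  proof eventually_elim
    case (elim n)
    define x y where "x = real n" and "y = real (3 * n)"
    have xy: "x > 0" "y > 0" "y = 3 * x" using elim by (auto simp: x_def y_def)
    \<comment> \<open>In the product of the \<open>g\<close> factors the factorials cancel and only
      these powers are left. The exponents \<open>a - c\<close> and \<open>b - d\<close> add up to
      -1, which balances the linear growth of \<open>6 * P + 6 * n + 3\<close>;
      \<open>y = 3 * x\<close> leaves the power of 3.\<close>
    have pw: "x powr a * y powr b / (x powr c * y powr d) = 3 powr (- 3 * Q - 3/2) / x"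
    proof -
      have "x powr a * y powr b / (x powr c * y powr d) = x powr (a - c) * y powr (b - d)"
        by (simp add: powr_diff)
      also have "y powr (b - d) = 3 powr (b - d) * x powr (b - d)"
        using xy by (simp add: powr_mult)
      also have "x powr (a - c) * (3 powr (b - d) * x powr (b - d)) = 3 powr (b - d) * x powr (a - c + (b - d))"
        by (simp add: powr_add mult_ac)
      also have "a - c + (b - d) = - 1" by (simp add: a_def b_def c_def d_def)
      also have "b - d = - 3 * Q - 3/2" by (simp add: b_def d_def)
      finally show ?thesis using xy by (simp add: powr_minus divide_simps)
    qed
    have "g a n * g b (3 * n) / (g c n * g d (3 * n))
      = Gamma (a + x) * Gamma (b + y) / (Gamma (c + x) * Gamma (d + y))
        / (x powr a * y powr b / (x powr c * y powr d))"
      by (simp add: g_def x_def y_def, simp only: mult_ac)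
    also have "\<dots> = Gamma (a + x) * Gamma (b + y) / (Gamma (c + x) * Gamma (d + y))
        / (3 powr (- 3 * Q - 3/2) / x)" unfolding pw ..
    finally have g: "3 powr (- 3 * Q - 3/2) * ((6 * P + 6 * n + 3) / real n)
        * (g a n * g b (3 * n) / (g c n * g d (3 * n)))
      = (6 * P + 6 * n + 3) * (Gamma (a + x) * Gamma (b + y) / (Gamma (c + x) * Gamma (d + y)))"
      using xy by (simp add: x_def)
    have f: "wz_summand (p + int n) q 0
      = (6 * P + 6 * n + 3) * (Gamma (a + x) * Gamma (b + y) / (Gamma (c + x) * Gamma (d + y)))
        * (- pi * (- 1) powi q)"
    proof -
      have "wz_summand (p + int n) q 0 = (6 * P + 6 * n + 3)
        * (Gamma (a + x) * Gamma (b + y) * (Gamma (3 * Q + 3/2) * Gamma (- 3 * Q - 1/2))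
           / (Gamma (c + x) * Gamma (d + y)))"
        by (simp add: wz_summand_def wz_term_def a_def b_def c_def d_def x_def y_def P_def Q_def algebra_simps)
      thus ?thesis using Gamma_reflection_three_halves[of q] by (simp add: Q_def)
    qed
    show ?case unfolding f g[symmetric] by (simp only: mult_ac)
  qed
  ultimately have "(\<lambda>n. wz_summand (p + int n) q 0)
     \<longlonglongrightarrow> - pi * (- 1) powi q * 3 powr (- 3 * Q - 3/2) * 6 * (1 * 1 / (1 * 1))"
    by (rule Lim_transform_eventually)
  also have "- pi * (- 1) powi q * 3 powr (- 3 * Q - 3/2) * 6 * (1 * 1 / (1 * 1))
     = - 2 * pi * (- 1) powi q * 3 powr (- 3 * real_of_int q - 1/2)"
  \<comment> \<open>Writing 6 as 2 * 3 lets the 3 raise the exponent from -3/2 to -1/2.\<close>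
  proof -
    have "3 powr (- 3 * Q - 1/2) = 3 powr (- 3 * Q - 3/2 + 1)" by (simp add: algebra_simps)
    also have "\<dots> = 3 powr (- 3 * Q - 3/2) * 3" by (subst powr_add) simp
    finally show ?thesis by (simp add: Q_def)
  qed
  finally show ?thesis .
qed

lemma wz_summand_tendsto:
  assumes "\<bar>q\<bar> \<le> p"
  shows "(\<lambda>n. wz_summand (p + int n) q k)
           \<longlonglongrightarrow> (if k = 0 then - 2 * pi * (- 1) powi q * 3 powr (- 3 * real_of_int q - 1/2) else 0)"
proof (induction k)
  case 0
  show ?case using wz_summand_0_tendsto[OF assms] by simp
next
  case (Suc k)
  define P Q K where "P = real_of_int p" and "Q = real_of_int q" and "K = real k"
  \<comment> \<open>These are the factors of the ratio that depend on \<open>p\<close>: degree one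
    over degree three, apart from a quotient tending to 1. Hence the ratio tends to 0, and each
    later term vanishes in the limit because its predecessor converges.\<close>
  have "(\<lambda>n. (8 * K + 6 * (P + real n) + 11) / (8 * K + 6 * (P + real n) + 3)
       * ((3 * (P + real n) + K + 3/2) / ((P + real n - Q + K + 1) * (3 * (P + real n) + 3 * Q + 2 * K + 3)
            * (3 * (P + real n) + 3 * Q + 2 * K + 4)))) \<longlonglongrightarrow> 0"
    by real_asymp
  from tendsto_mult_right[OF this, of "(3 * Q + K + 3/2) * (2 * K - 3 * Q - 1/2) * (2 * K - 3 * Q + 1/2) / (9 * (K + 1))"]
  have "(\<lambda>n. (8 * K + 6 * (P + real n) + 11) / (8 * K + 6 * (P + real n) + 3) * wz_ratio (P + real n) Q K) \<longlonglongrightarrow> 0"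
    unfolding wz_ratio_def by (simp only: times_divide_times_eq times_divide_eq_left
        times_divide_eq_right divide_divide_eq_left mult_ac mult_zero_left div_0)
  from tendsto_mult[OF this Suc.IH] show ?case
    using assms by (simp add: wz_summand_Suc P_def Q_def K_def)
qed

section \<open>Evaluation of the sum\<close>

lemma suminf_wz_summand:
  assumes "\<bar>q\<bar> \<le> p"
  shows "suminf (wz_summand p q) = - 2 * pi * (- 1) powi q * 3 powr (- 3 * real_of_int q - 1/2)"
proof -
  define L where "L = - 2 * pi * (- 1) powi q * 3 powr (- 3 * real_of_int q - 1/2)"
  \<comment> \<open>A convergent sequence is bounded at every index, so one \<open>B\<close> serves
    all \<open>n\<close>.\<close>
  obtain B where B: "\<And>n. \<bar>wz_summand (p + int n) q 0\<bar> \<le> B"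
    using convergent_imp_Bseq[OF convergentI[OF wz_summand_0_tendsto[OF assms]]]
    by (auto simp: Bseq_def)
  define M where "M = (\<lambda>k. B * (\<Prod>j<k. \<bar>3 * real_of_int q + real j + 3/2\<bar> / (2 * (real j + 1))))"
  have le: "norm (wz_summand (p + int n) q k) \<le> M k" if "n \<ge> nat (4 * \<bar>q\<bar> + 11)" for n k
    unfolding M_def using wz_summand_bound[of q "p + int n" B k] B[of n] that assms by simp
  have "(\<lambda>n. suminf (wz_summand (p + int n) q)) \<longlonglongrightarrow> (\<Sum>k. if k = 0 then L else 0)"
  proof (rule tannerys_theorem[THEN conjunct2, THEN conjunct2])
    show "(\<lambda>n. wz_summand (p + int n) q k) \<longlonglongrightarrow> (if k = 0 then L else 0)" for k
      using wz_summand_tendsto[OF assms] unfolding L_def .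
    show "summable M" unfolding M_def by (rule wz_majorant_summable)
    \<comment> \<open>The domination holds for every \<open>k\<close>, so in the product filter only
      \<open>n\<close> has to be large.\<close>
    have "eventually (\<lambda>n. n \<ge> nat (4 * \<bar>q\<bar> + 11)) sequentially" by (rule eventually_ge_at_top)
    from eventually_prodI[OF always_eventually[of "\<lambda>_. True"] this]
    show "eventually (\<lambda>(k, n). norm (wz_summand (p + int n) q k) \<le> M k) (sequentially \<times>\<^sub>F sequentially)"
      by (rule eventually_mono) (use le in auto)
  qed auto
  moreover have "(\<Sum>k. if k = 0 then L else 0) = L"
    using suminf_finite[of "{0}" "\<lambda>k. if k = 0 then L else 0"] by simp
  \<comment> \<open>The sum is the same for all \<open>n\<close>, so its limit is its value.\<close>
  ultimately have "(\<lambda>n::nat. suminf (wz_summand p q)) \<longlonglongrightarrow> L"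
    unfolding suminf_wz_summand_shift[OF assms] by simp
  thus ?thesis unfolding L_def by (simp add: LIMSEQ_const_iff)
qed

section \<open>Return to shifted factorials\<close>

lemma Gamma_half_integers: "Gamma (3/2 :: real) = sqrt pi / 2" "Gamma (- 1/2 :: real) = - 2 * sqrt pi"
proof -
  have "(1/2::real) \<notin> \<int>\<^sub>\<le>\<^sub>0" "(- 1/2::real) \<notin> \<int>\<^sub>\<le>\<^sub>0"
    using nonpos_Ints_add_half[of 0 "1/2"] nonpos_Ints_add_half[of "- 1" "- 1/2"] by auto
  from this[THEN Gamma_plus1] show "Gamma (3/2 :: real) = sqrt pi / 2" "Gamma (- 1/2 :: real) = - 2 * sqrt pi"
    by (simp_all add: Gamma_one_half_real)
qed

lemma shifted_factorial_of_real:
  "shifted_factorial (of_real x) n = of_real (Gamma (x + of_int n) / Gamma x)"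
  by (simp add: shifted_factorial_def flip: Gamma_complex_of_real)

theorem theorem6:
  fixes p q :: int and f :: "nat \<Rightarrow> complex"
  assumes "min (p + q) (p - q) \<ge> 0"
  defines "f \<equiv> (\<lambda>k. (shifted_factorial (3/2) (int k + 3 * p) * shifted_factorial (3/2) (int k + 3 * q)
                      * shifted_factorial (- 1/2) (2 * int k - 3 * q))
                   / (fact k * fact (nat (int k + p - q)) * fact (nat (2 * int k + 3 * p + 3 * q + 2)))
                   * ((8 * of_nat k + 6 * of_int p + 3) / 9 ^ k))"
  shows "summable f \<and>
         4 * (- 1) powi q / (3 powr (3 * of_int q + 1/2) * of_real pi)
           = shifted_factorial (1/2) (p + 2 * q + 1) * (\<Sum>k. f k)"
proof -
  have pq: "\<bar>q\<bar> \<le> p" using assms(1) by auto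
  define A where "A = Gamma (real_of_int (p + 2 * q) + 3/2) / sqrt pi"
  have "real_of_int (p + 2 * q) + 3/2 \<notin> \<int>\<^sub>\<le>\<^sub>0"
    by (rule nonpos_Ints_add_half[of "p + 2 * q + 1"]) auto
  hence A: "A \<noteq> 0" by (simp add: A_def Gamma_eq_zero_iff)
  have sfA: "shifted_factorial (1/2) (p + 2 * q + 1) = of_real A"
    using shifted_factorial_of_real[of "1/2" "p + 2 * q + 1"]
    by (simp add: A_def Gamma_one_half_real add_ac)
  have sf32: "shifted_factorial (3/2) n = of_real (Gamma (n + 3/2) / (sqrt pi / 2))" for n
    using shifted_factorial_of_real[of "3/2" n] by (simp add: Gamma_half_integers add_ac)
  have sfm12: "shifted_factorial (- 1/2) n = of_real (Gamma (n - 1/2) / (- 2 * sqrt pi))" for n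
    using shifted_factorial_of_real[of "- 1/2" n] unfolding Gamma_half_integers by (simp add: add_ac)
  \<comment> \<open>The factor \<open>(sqrt pi / 2)^2 * (- 2 * sqrt pi)\<close> comes from the three
    shifted factorials, and \<open>A * sqrt pi\<close> is the Gamma factor present in
    \<open>wz_summand\<close> but not in \<open>f\<close>. Together they give
    \<open>- 2 / (pi^2 * A)\<close>.\<close>
  have fk: "f k = of_real (wz_summand p q k * (- 2 / (pi\<^sup>2 * A)))" for k
  proof -
    \<comment> \<open>Since \<open>p - q\<close> and \<open>p + q\<close> are nonnegative,
      \<open>nat\<close> truncates nothing here or in \<open>fact2\<close>.\<close>
    have fact1: "(fact (nat (int k + p - q)) :: real) = Gamma (p - q + real k + 1)"
      using Gamma_fact[of "nat (int k + p - q)", where ?'a = real] pq by (simp add: algebra_simps)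
    have fact2: "(fact (nat (2 * int k + 3 * p + 3 * q + 2)) :: real) = Gamma (3 * p + 3 * q + 2 * real k + 3)"
      using Gamma_fact[of "nat (2 * int k + 3 * p + 3 * q + 2)", where ?'a = real] pq
      by (simp add: algebra_simps)
    have "complex_of_real (sqrt pi) * of_real (sqrt pi) = of_real pi"
      by (simp flip: of_real_mult)
    hence "f k = of_real ((Gamma (real_of_int (int k + 3 * p) + 3/2) / (sqrt pi / 2)
        * (Gamma (real_of_int (int k + 3 * q) + 3/2) / (sqrt pi / 2))
        * (Gamma (real_of_int (2 * int k - 3 * q) - 1/2) / (- 2 * sqrt pi)))
        / (fact k * fact (nat (int k + p - q)) * fact (nat (2 * int k + 3 * p + 3 * q + 2)))
        * ((8 * real k + 6 * p + 3) / 9 ^ k))"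
      unfolding f_def sf32 sfm12 by simp
    also have "\<dots> = of_real (wz_summand p q k * (- 2 / (pi\<^sup>2 * A)))"
    proof -
      have A_eq: "Gamma (real_of_int (p + 2 * q) + 3/2) = A * sqrt pi" by (simp add: A_def)
      \<comment> \<open>With \<open>pi\<close> written as \<open>u * u\<close>, comparing the
        constants is a rational identity in \<open>u\<close>.\<close>
      define u where "u = sqrt pi"
      have u: "pi = u * u" "u \<noteq> 0" by (simp_all add: u_def)
      have i: "real_of_int (int k + 3 * p) = 3 * p + real k" "real_of_int (int k + 3 * q) = 3 * q + real k"
        "real_of_int (2 * int k - 3 * q) = 2 * real k - 3 * q" by simp_all
      show ?thesis
        unfolding i fact1 fact2 wz_summand_def wz_term_def u_def[symmetric]
        unfolding u(1) using u(2) A A_eq[folded u_def] by (intro arg_cong[where f = of_real]) (simp add: power2_eq_square mult_ac)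
    qed
    finally show ?thesis .
  qed
  have "wz_summand p q sums (- 2 * pi * (- 1) powi q * 3 powr (- 3 * real_of_int q - 1/2))"
    using wz_summand_summable[OF pq] suminf_wz_summand[OF pq] by (simp add: sums_iff)
  hence "(\<lambda>k. complex_of_real (wz_summand p q k * (- 2 / (pi\<^sup>2 * A)))) sums
      complex_of_real ((- 2 * pi * (- 1) powi q * 3 powr (- 3 * real_of_int q - 1/2)) * (- 2 / (pi\<^sup>2 * A)))"
    by (intro sums_of_real sums_mult2)
  hence "f sums of_real ((- 2 * pi * (- 1) powi q * 3 powr (- 3 * real_of_int q - 1/2)) * (- 2 / (pi\<^sup>2 * A)))"
    unfolding fk[symmetric] .
  moreover have "complex_of_real A * of_real ((- 2 * pi * (- 1) powi q * 3 powr (- 3 * real_of_int q - 1/2)) * (- 2 / (pi\<^sup>2 * A)))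
     = 4 * (- 1) powi q / (3 powr (3 * of_int q + 1/2) * of_real pi)"
  proof -
    have "(3::complex) powr (3 * of_int q + 1/2) = of_real (3 powr (3 * q + 1/2))"
      using powr_of_real[of 3 "3 * q + 1/2"] by simp
    moreover have "3 powr (- 3 * real_of_int q - 1/2) = 1 / 3 powr (3 * q + 1/2)"
      using powr_minus_divide[of 3 "3 * real_of_int q + 1/2"] by simp
    ultimately show ?thesis using A by (simp add: power2_eq_square)
  qed
  ultimately show ?thesis unfolding sfA by (auto simp: sums_iff)
qed

end
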